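(* Let $F=f+g$ satisfy Assumption 1 (i) and (ii) given in the context, and let $(x_k)_{k\ge 0}$ be a sequence generated by the RCCM algorithm described in the context with $M_i>0$ for all $i=1,\dots,N$; assume that it is bounded. Assume that $F$ satisfies the KL property given in the context (with compact set $\mathcal{X}$, value $F_*$, and constants $\gamma,\epsilon,\sigma_q>0$, $q>1$), and that there exists $k_0\ge 0$ such that for every $k\ge k_0$, $\mathrm{dist}(x_k,\mathcal{X})\le\gamma$ and $F_*<F(x_k)<F_*+\epsilon$. Let $\Delta_k:=F(x_k)-F_*$. Then there exists a constant $C>0$, independent of $k$, with $\min_{s_{k+1}\in\partial F(x_{k+1})}\|s_{k+1}\|\le C\|x_{k+1}-x_k\|$ for all $k\ge 0$, and with $\mu:=\frac{M_{\min}}{2C^2\sigma_q^{2/q}}>0$ the following hold: (a) if $q\in(1,2)$, then $\Delta_k=\mathcal{O}\big(k^{-\frac{q}{2-q}}\big)$ as $k\to\infty$; (b) if $q=2$, then $\Delta_k\le\left(\frac{1}{1+\mu}\right)^{k-k_0}\Delta_{k_0}$ for all $k\ge k_0$; (c) if $q>2$, then there is $\delta>0$ such that $\Delta_{k+1}\le\left(\frac{\Delta_k}{\mu}\right)^{q/2}$ for every $k\ge k_0$ with $\Delta_k\le\delta$, and $\Delta_k$ converges to $0$ superlinearly, i.e. $\Delta_k\to 0$ and $\Delta_{k+1}/\Delta_k\to 0$.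
   Context: Blocks. Let $n=\sum_{i=1}^N n_i$, let $E=[E_1,\dots,E_N]$ be a column permutation of the $n\times n$ identity matrix partitioned into $E_i\in\mathbb{R}^{n\times n_i}$; for $x\in\mathbb{R}^n$ put $x^{(i)}=E_i^Tx\in\mathbb{R}^{n_i}$, so $x=\sum_i E_i x^{(i)}$, also written $x=(x^{(1)},\dots,x^{(N)})$. $\|\cdot\|$ is the Euclidean norm and $\mathrm{dist}$ the Euclidean distance to a set. $\partial F$ is the limiting subdifferential. Problem. $F^*=\min_{x\in\mathbb{R}^n}F(x)$, $F(x):=f(x)+g(x)$, with $f:\mathbb{R}^n\to\mathbb{R}$ and $g:\mathbb{R}^n\to(-\infty,+\infty]$, both possibly nonconvex. Assumption 1. (i) $f$ is twice continuously differentiable; $g$ is proper, lower semicontinuous and separable, $g(x)=\sum_{i=1}^N g_i(x^{(i)})$; and for every $i$ and every fixed $\hat y=(y^{(1)},\dots,y^{(i-1)},y^{(i+1)},\dots,y^{(N)})$ one has $\inf_{x^{(i)}\in\mathbb{R}^{n_i}} f(x^{(i)},\hat y)+g_i(x^{(i)})>-\infty$, where $f(x^{(i)},\hat y)$ is the value of $f$ at the vector whose $i$-th block is $x^{(i)}$ and whose other blocks are those of $\hat y$. (ii) The problem has a solution (hence $F^*>-\infty$). RCCM (Regularized Cyclic Coordinate Minimization) algorithm. Given regularization parameters $M_i\ge 0$, $i=1,\dots,N$, and $x_0\in\mathrm{dom}\,g$, for $k=0,1,2,\dots$ and, within each $k$, successively for $i=1,\dots,N$, choose $$x_{k+1}^{(i)}\in\arg\min_{x^{(i)}\in\mathbb{R}^{n_i}}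 f(x^{(i)},\hat x_{k,i})+g_i(x^{(i)})+\frac{M_i}{2}\|x^{(i)}-x_k^{(i)}\|^2,$$ where $\hat x_{k,i}=(x_{k+1}^{(1)},\dots,x_{k+1}^{(i-1)},x_k^{(i+1)},\dots,x_k^{(N)})$; then set $x_{k+1}=(x_{k+1}^{(1)},\dots,x_{k+1}^{(N)})$. $M_{\min}=\min(M_1,\dots,M_N)$. KL property. Let $\mathcal{X}$ be a given (nonempty) compact set on which $F$ takes a constant value $F_*$, and let $\sigma_q>0$, $q>1$. $F$ satisfies the KL property if there exist $\gamma,\epsilon>0$ such that for all $x$ with $\mathrm{dist}(x,\mathcal{X})\le\gamma$ and $F_*<F(x)<F_*+\epsilon$, $$F(x)-F_*\le\sigma_q\,\mathrm{dist}(0,\partial F(x))^q.$$ *)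

theory Defs
  imports "HOL-Analysis.Analysis" "HOL-Library.Landau_Symbols"
begin

section \<open>Blocks\<close>

text \<open>
  The space \<open>\<real>\<^sup>n\<close> is \<open>real ^ 'n\<close>. The matrix \<open>E\<^sub>i\<close> is given by the indices of its columns: its \<open>l\<close>-th
  column (\<open>l < d i\<close>, where \<open>d i\<close> is the block size \<open>n\<^sub>i\<close>) is the unit vector \<open>axis (c i l) 1\<close>.
  That \<open>[E\<^sub>1, \<dots>, E\<^sub>N]\<close> is a column permutation of the identity matrix means that \<open>c\<close> enumerates all
  coordinates without repetition; in particular \<open>CARD('n) = (\<Sum>i=1..N. d i)\<close>.
  A vector of \<open>\<real>\<^sup>m\<close> for a variable \<open>m\<close> is an element of \<open>topspace (Euclidean_space m)\<close>, that is, a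
  function on the naturals vanishing from \<open>m\<close> on.
\<close>

definition block_structure :: "nat \<Rightarrow> (nat \<Rightarrow> nat) \<Rightarrow> (nat \<Rightarrow> nat \<Rightarrow> 'n::finite) \<Rightarrow> bool" where
  "block_structure N d c \<longleftrightarrow>
     bij_betw (\<lambda>(i, l). c i l) (SIGMA i:{1..N}. {..<d i}) UNIV"

abbreviation Rspace :: "nat \<Rightarrow> (nat \<Rightarrow> real) set" where
  "Rspace m \<equiv> topspace (Euclidean_space m)"

definition Rnorm :: "nat \<Rightarrow> (nat \<Rightarrow> real) \<Rightarrow> real" where
  "Rnorm m v = L2_set v {..<m}"

text \<open>\<open>E\<^sub>i v\<close> and \<open>E\<^sub>i\<^sup>T x\<close>:\<close>

definition embed ::
  "(nat \<Rightarrow> nat) \<Rightarrow> (nat \<Rightarrow> nat \<Rightarrow> 'n::finite) \<Rightarrow> nat \<Rightarrow> (nat \<Rightarrow> real) \<Rightarrow> real ^ 'n" where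
  "embed d c i v = (\<Sum>l<d i. v l *\<^sub>R axis (c i l) 1)"

definition block ::
  "(nat \<Rightarrow> nat) \<Rightarrow> (nat \<Rightarrow> nat \<Rightarrow> 'n::finite) \<Rightarrow> real ^ 'n \<Rightarrow> nat \<Rightarrow> (nat \<Rightarrow> real)" where
  "block d c x i = (\<lambda>l. if l < d i then x $ c i l else 0)"

text \<open>The vector \<open>(z\<^sup>(\<^sup>1\<^sup>), \<dots>, z\<^sup>(\<^sup>N\<^sup>))\<close>:\<close>

definition assemble ::
  "nat \<Rightarrow> (nat \<Rightarrow> nat) \<Rightarrow> (nat \<Rightarrow> nat \<Rightarrow> 'n::finite) \<Rightarrow> (nat \<Rightarrow> nat \<Rightarrow> real) \<Rightarrow> real ^ 'n" where
  "assemble N d c z = (\<Sum>i=1..N. embed d c i (z i))"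

section \<open>The problem\<close>

definition C2 :: "('a::real_normed_vector \<Rightarrow> real) \<Rightarrow> bool" where
  "C2 f \<longleftrightarrow> (\<exists>(D :: 'a \<Rightarrow> ('a \<Rightarrow>\<^sub>L real)) (D2 :: 'a \<Rightarrow> ('a \<Rightarrow>\<^sub>L ('a \<Rightarrow>\<^sub>L real))).
     (\<forall>x. (f has_derivative blinfun_apply (D x)) (at x)) \<and>
     (\<forall>x. (D has_derivative blinfun_apply (D2 x)) (at x)) \<and>
     continuous_on UNIV D2)"

definition proper :: "('a \<Rightarrow> ereal) \<Rightarrow> bool" where
  "proper g \<longleftrightarrow> (\<forall>x. g x \<noteq> -\<infinity>) \<and> (\<exists>x. g x \<noteq> \<infinity>)"

definition lsc :: "('a::topological_space \<Rightarrow> ereal) \<Rightarrow> bool" where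
  "lsc g \<longleftrightarrow> (\<forall>x. g x \<le> Liminf (at x) g)"

definition objective :: "('a \<Rightarrow> real) \<Rightarrow> ('a \<Rightarrow> ereal) \<Rightarrow> 'a \<Rightarrow> ereal" where
  "objective f g x = ereal (f x) + g x"

text \<open>In the last condition the component \<open>y i\<close> of \<open>y\<close> is irrelevant.\<close>

definition assumption1_i ::
  "nat \<Rightarrow> (nat \<Rightarrow> nat) \<Rightarrow> (nat \<Rightarrow> nat \<Rightarrow> 'n::finite) \<Rightarrow>
   (real ^ 'n \<Rightarrow> real) \<Rightarrow> (real ^ 'n \<Rightarrow> ereal) \<Rightarrow> (nat \<Rightarrow> (nat \<Rightarrow> real) \<Rightarrow> ereal) \<Rightarrow> bool" where
  "assumption1_i N d c f g gs \<longleftrightarrow>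
     C2 f \<and> proper g \<and> lsc g \<and>
     (\<forall>i\<in>{1..N}. \<forall>v\<in>Rspace (d i). gs i v \<noteq> -\<infinity>) \<and>
     (\<forall>x. g x = (\<Sum>i=1..N. gs i (block d c x i))) \<and>
     (\<forall>i\<in>{1..N}. \<forall>y. (\<forall>j\<in>{1..N}. y j \<in> Rspace (d j)) \<longrightarrow>
        (INF v\<in>Rspace (d i). ereal (f (assemble N d c (y(i := v)))) + gs i v) > -\<infinity>)"

definition assumption1_ii :: "('a \<Rightarrow> real) \<Rightarrow> ('a \<Rightarrow> ereal) \<Rightarrow> bool" where
  "assumption1_ii f g \<longleftrightarrow> (\<exists>x. \<forall>y. objective f g x \<le> objective f g y)"

section \<open>The algorithm\<close>

text \<open>The \<open>i\<close>-th component of \<open>xhat d c x k i\<close> is irrelevant; it is overwritten wherever it is used.\<close>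

definition xhat ::
  "(nat \<Rightarrow> nat) \<Rightarrow> (nat \<Rightarrow> nat \<Rightarrow> 'n::finite) \<Rightarrow> (nat \<Rightarrow> real ^ 'n) \<Rightarrow> nat \<Rightarrow> nat \<Rightarrow>
   (nat \<Rightarrow> nat \<Rightarrow> real)" where
  "xhat d c x k i = (\<lambda>j. if j < i then block d c (x (Suc k)) j else block d c (x k) j)"

definition RCCM ::
  "nat \<Rightarrow> (nat \<Rightarrow> nat) \<Rightarrow> (nat \<Rightarrow> nat \<Rightarrow> 'n::finite) \<Rightarrow>
   (real ^ 'n \<Rightarrow> real) \<Rightarrow> (real ^ 'n \<Rightarrow> ereal) \<Rightarrow> (nat \<Rightarrow> (nat \<Rightarrow> real) \<Rightarrow> ereal) \<Rightarrow>
   (nat \<Rightarrow> real) \<Rightarrow> (nat \<Rightarrow> real ^ 'n) \<Rightarrow> bool" where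
  "RCCM N d c f g gs M x \<longleftrightarrow>
     (\<forall>i\<in>{1..N}. 0 \<le> M i) \<and>
     g (x 0) < \<infinity> \<and>
     (\<forall>k. \<forall>i\<in>{1..N}.
        is_arg_min
          (\<lambda>v. ereal (f (assemble N d c ((xhat d c x k i)(i := v)))) + gs i v
               + ereal (M i / 2 * (Rnorm (d i) (\<lambda>l. v l - block d c (x k) i l))\<^sup>2))
          (\<lambda>v. v \<in> Rspace (d i))
          (block d c (x (Suc k)) i))"

section \<open>Limiting subdifferential and KL property\<close>

text \<open>Regular (Frechet) subdifferential, and the limiting subdifferential in the sense of
  Mordukhovich; both are empty outside the domain of \<open>F\<close>.\<close>

definition regular_subdiff :: "('a::real_inner \<Rightarrow> ereal) \<Rightarrow> 'a \<Rightarrow> 'a set" where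
  "regular_subdiff F x =
     {s. \<bar>F x\<bar> \<noteq> \<infinity> \<and>
         0 \<le> Liminf (at x) (\<lambda>y. (F y - F x - ereal (s \<bullet> (y - x))) / ereal (norm (y - x)))}"

definition limiting_subdiff :: "('a::real_inner \<Rightarrow> ereal) \<Rightarrow> 'a \<Rightarrow> 'a set" where
  "limiting_subdiff F x =
     {s. \<bar>F x\<bar> \<noteq> \<infinity> \<and>
         (\<exists>y t. y \<longlonglongrightarrow> x \<and> (\<lambda>k. F (y k)) \<longlonglongrightarrow> F x \<and>
                (\<forall>k. t k \<in> regular_subdiff F (y k)) \<and> t \<longlonglongrightarrow> s)}"

text \<open>
  The distance to the empty set is \<open>+\<infinity>\<close>, whereas \<^term>\<open>infdist\<close> to the empty set is \<open>0\<close>;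
  hence the inequality is only required where the subdifferential is nonempty.
\<close>

definition KL_property ::
  "('a::real_inner \<Rightarrow> ereal) \<Rightarrow> 'a set \<Rightarrow> real \<Rightarrow> real \<Rightarrow> real \<Rightarrow> real \<Rightarrow> real \<Rightarrow> bool" where
  "KL_property F X Fstar \<sigma> q \<gamma> \<epsilon> \<longleftrightarrow>
     compact X \<and> X \<noteq> {} \<and> (\<forall>x\<in>X. F x = ereal Fstar) \<and>
     0 < \<sigma> \<and> 1 < q \<and> 0 < \<gamma> \<and> 0 < \<epsilon> \<and>
     (\<forall>x. infdist x X \<le> \<gamma> \<and> ereal Fstar < F x \<and> F x < ereal (Fstar + \<epsilon>) \<and>
          limiting_subdiff F x \<noteq> {} \<longrightarrow>
        F x - ereal Fstar \<le> ereal (\<sigma> * infdist 0 (limiting_subdiff F x) powr q))"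

text \<open>The optimality gap along the iterates. Every iterate lies in the domain of \<open>F\<close> (because the
  starting point does), so that no infinite value is truncated by \<^term>\<open>real_of_ereal\<close>.\<close>

definition gap :: "('a \<Rightarrow> ereal) \<Rightarrow> real \<Rightarrow> (nat \<Rightarrow> 'a) \<Rightarrow> nat \<Rightarrow> real" where
  "gap F Fstar x k = real_of_ereal (F (x k)) - Fstar"

end

theory Submission
  imports Defs
begin

text \<open>
  Comparing each block minimiser with the old block and telescoping over the blocks gives the sufficient
  decrease \<open>F (x\<^sub>k\<^sub>+\<^sub>1) + M\<^sub>m\<^sub>i\<^sub>n / 2 * \<parallel>x\<^sub>k\<^sub>+\<^sub>1 - x\<^sub>k\<parallel>\<^sup>2 \<le> F (x\<^sub>k)\<close>. Comparing it with an arbitrary block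
  gives a smooth minorant of \<open>F\<close> touching \<open>F\<close> at \<open>x\<^sub>k\<^sub>+\<^sub>1\<close>; its gradient there is a subgradient, and it is
  \<open>O(\<parallel>x\<^sub>k\<^sub>+\<^sub>1 - x\<^sub>k\<parallel>)\<close> because \<open>\<nabla>f\<close> is Lipschitz on bounded sets. With the KL inequality this yields
  \<open>\<mu> \<Delta>\<^sub>k\<^sub>+\<^sub>1\<^sup>2\<^sup>/\<^sup>q \<le> \<Delta>\<^sub>k - \<Delta>\<^sub>k\<^sub>+\<^sub>1\<close>, from which the three rates follow by elementary analysis.
\<close>

section \<open>Sequences with power-type decrease\<close>

text \<open>Discarding \<open>- D (Suc k)\<close> on the right and taking the power
  \<open>q / 2\<close> gives the one-step bound. Since \<open>q / 2 > 1\<close>, dividing it by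
  \<open>D k\<close> leaves a positive power of \<open>D k\<close>, so the ratio vanishes once
  \<open>D\<close> does.\<close>

lemma power_recurrence_superlinear:
  fixes D :: "nat \<Rightarrow> real"
  assumes \<mu>: "0 < \<mu>" and q: "2 < q"
    and pos: "\<And>k. k0 \<le> k \<Longrightarrow> 0 < D k"
    and rec: "\<And>k. k0 \<le> k \<Longrightarrow> \<mu> * D (Suc k) powr (2 / q) \<le> D k - D (Suc k)"
  shows "k0 \<le> k \<Longrightarrow> D (Suc k) \<le> (D k / \<mu>) powr (q / 2)"
    and "D \<longlonglongrightarrow> 0" and "(\<lambda>k. D (Suc k) / D k) \<longlonglongrightarrow> 0"
proof -
  show step: "D (Suc k) \<le> (D k / \<mu>) powr (q / 2)" if "k0 \<le> k" for k
  proof -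
    have "D (Suc k) powr (2 / q) \<le> D k / \<mu>"
      using rec[OF that] pos[of "Suc k"] that \<mu> by (simp add: field_simps)
    then have "(D (Suc k) powr (2 / q)) powr (q / 2) \<le> (D k / \<mu>) powr (q / 2)"
      using q by (intro powr_mono2) auto
    then show ?thesis using q pos[of "Suc k"] that by (simp add: powr_powr)
  qed
  \<comment> \<open>The shift makes positivity and the recurrence hold at every index, so monotone
    convergence applies to the whole sequence.\<close>
  define E where "E k = D (k + k0)" for k
  have Epos: "0 < E k" for k using pos by (simp add: E_def)
  have Erec: "\<mu> * E (Suc k) powr (2 / q) \<le> E k - E (Suc k)" for k
    using rec[of "k + k0"] by (simp add: E_def)
  have Edec: "decseq E"
  proof (rule decseq_SucI)
    fix k show "E (Suc k) \<le> E k"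
      using Erec[of k] \<mu> by (smt (verit) mult_nonneg_nonneg powr_ge_zero)
  qed
  then obtain l where l: "E \<longlonglongrightarrow> l"
    using decseq_convergent[of E 0] Epos less_imp_le by metis
  \<comment> \<open>Whatever the limit \<open>l\<close> is, consecutive differences vanish; by the
    recurrence they dominate \<open>E (Suc k) powr (2 / q)\<close>, which forces \<open>l\<close> to
    be 0.\<close>
  have "(\<lambda>k. (E k - E (Suc k)) / \<mu>) \<longlonglongrightarrow> (l - l) / \<mu>"
    using \<mu> by (intro tendsto_intros l LIMSEQ_Suc[OF l]) auto
  then have l0: "(\<lambda>k. (E k - E (Suc k)) / \<mu>) \<longlonglongrightarrow> 0" by simp
  have "(\<lambda>k. E (Suc k) powr (2 / q)) \<longlonglongrightarrow> 0"
    by (rule tendsto_sandwich[OF _ _ tendsto_const l0])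
      (use Erec \<mu> in \<open>auto simp: field_simps intro!: always_eventually\<close>)
  then have "(\<lambda>k. (E (Suc k) powr (2 / q)) powr (q / 2)) \<longlonglongrightarrow> 0 powr (q / 2)"
    using q by (intro tendsto_powr') auto
  moreover have "(E (Suc k) powr (2 / q)) powr (q / 2) = E (Suc k)" for k
    using q Epos[of "Suc k"] by (simp add: powr_powr)
  ultimately have "(\<lambda>k. E (Suc k)) \<longlonglongrightarrow> 0" by simp
  then have "E \<longlonglongrightarrow> 0" by (rule LIMSEQ_imp_Suc)
  then show D0: "D \<longlonglongrightarrow> 0" unfolding E_def by (rule LIMSEQ_offset)
  have "\<forall>\<^sub>F k in sequentially. 0 \<le> D k"
    using eventually_ge_at_top[of k0] by eventually_elim (simp add: pos less_imp_le)
  then have "(\<lambda>k. D k powr (q / 2 - 1) / \<mu> powr (q / 2)) \<longlonglongrightarrow> 0 powr (q / 2 - 1) / \<mu> powr (q / 2)"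
    using q \<mu> D0 by (intro tendsto_divide tendsto_powr' tendsto_const) auto
  then have up: "(\<lambda>k. D k powr (q / 2 - 1) / \<mu> powr (q / 2)) \<longlonglongrightarrow> 0" by simp
  have bound: "D (Suc k) / D k \<le> D k powr (q / 2 - 1) / \<mu> powr (q / 2)" if "k0 \<le> k" for k
  proof -
    have "D (Suc k) / D k \<le> (D k / \<mu>) powr (q / 2) / D k"
      using step[OF that] pos[OF that] by (simp add: divide_right_mono)
    also have "\<dots> = D k powr (q / 2 - 1) / \<mu> powr (q / 2)"
      using pos[OF that] \<mu> by (simp add: powr_divide powr_diff)
    finally show ?thesis .
  qed
  show "(\<lambda>k. D (Suc k) / D k) \<longlonglongrightarrow> 0"
  proof (rule tendsto_sandwich[OF _ _ tendsto_const up])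
    show "\<forall>\<^sub>F k in sequentially. 0 \<le> D (Suc k) / D k"
      using eventually_ge_at_top[of k0] by eventually_elim (simp add: pos less_imp_le)
    show "\<forall>\<^sub>F k in sequentially. D (Suc k) / D k \<le> D k powr (q / 2 - 1) / \<mu> powr (q / 2)"
      using eventually_ge_at_top[of k0] by eventually_elim (rule bound)
  qed
qed

text \<open>Convexity of t powr (-\<alpha>): the mean value point lies to the left of
  \<open>a\<close>, where the slope is at least as steep as at \<open>a\<close>.\<close>

lemma powr_neg_tangent:
  fixes a b \<alpha> :: real
  assumes "0 < b" "b \<le> a" "0 < \<alpha>"
  shows "\<alpha> * a powr (-\<alpha> - 1) * (a - b) \<le> b powr (-\<alpha>) - a powr (-\<alpha>)"
proof (cases "b = a")
  case False
  have "\<exists>z>b. z < a \<and> a powr (-\<alpha>) - b powr (-\<alpha>) = (a - b) * (-\<alpha> * z powr (-\<alpha> - 1))"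
    using assms False by (intro MVT2) (auto intro!: derivative_eq_intros simp: powr_diff)
  then obtain z where z: "b < z" "z < a"
    "a powr (-\<alpha>) - b powr (-\<alpha>) = (a - b) * (-\<alpha> * z powr (-\<alpha> - 1))" by blast
  have "a powr (-\<alpha> - 1) \<le> z powr (-\<alpha> - 1)"
    using z assms by (intro powr_mono2') auto
  then have "\<alpha> * (a - b) * a powr (-\<alpha> - 1) \<le> \<alpha> * (a - b) * z powr (-\<alpha> - 1)"
    using assms by (intro mult_left_mono) auto
  then show ?thesis using z(3) by (simp add: algebra_simps)
qed simp

text \<open>Discrete analogue of D' = -\<mu> D powr (2 / q): along its solutions D powr (-\<alpha>)
  with \<alpha> = 2 / q - 1 grows linearly, and 1 / \<alpha> = q / (2 - q) is the claimed
  exponent.\<close>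

lemma power_recurrence_sublinear:
  fixes D :: "nat \<Rightarrow> real"
  assumes \<mu>: "0 < \<mu>" and q: "0 < q" "q < 2"
    and pos: "\<And>k. k0 \<le> k \<Longrightarrow> 0 < D k"
    and rec: "\<And>k. k0 \<le> k \<Longrightarrow> \<mu> * D (Suc k) powr (2 / q) \<le> D k - D (Suc k)"
  shows "D \<in> O(\<lambda>k. real k powr (- (q / (2 - q))))"
proof -
  define \<alpha> where "\<alpha> = 2 / q - 1"
  have \<alpha>: "0 < \<alpha>" using q by (simp add: \<alpha>_def field_simps)
  \<comment> \<open>The smaller of the two guaranteed gains: the first uses a ratio of at least 1/2;
    in the second, halving multiplies the potential by at least 2 powr \<alpha>, and its least value
    from \<open>k0\<close> on is the one at \<open>k0\<close>.\<close>
  define \<beta> where "\<beta> = min (\<alpha> * \<mu> / 2 powr (2 / q)) ((2 powr \<alpha> - 1) * D k0 powr (-\<alpha>))"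
  have "1 < 2 powr \<alpha>" using \<alpha> by (simp add: gr_one_powr)
  then have \<beta>: "0 < \<beta>" using \<alpha> \<mu> pos[of k0] by (simp add: \<beta>_def)
  have dec: "D (Suc k) \<le> D k" if "k0 \<le> k" for k
    using rec[OF that] \<mu> by (smt (verit) mult_nonneg_nonneg powr_ge_zero)
  have le0: "D k \<le> D k0" if "k0 \<le> k" for k
    using that by (induction rule: dec_induct) (auto intro: order_trans dec)
  \<comment> \<open>The potential \<open>D k powr (-\<alpha>)\<close> gains a fixed amount: by convexity if \<open>D\<close> at most halves,
    and trivially otherwise.\<close>
  have grow: "\<beta> \<le> D (Suc k) powr (-\<alpha>) - D k powr (-\<alpha>)" if k: "k0 \<le> k" for k
  proof (cases "D k / 2 \<le> D (Suc k)")
    case True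
    have p: "0 < D k" "0 < D (Suc k)" using pos k by auto
    have "\<beta> \<le> \<alpha> * \<mu> * (1 / 2) powr (2 / q)" by (simp add: \<beta>_def powr_divide)
    also have "\<dots> \<le> \<alpha> * \<mu> * (D (Suc k) / D k) powr (2 / q)"
      using True p \<alpha> \<mu> q by (intro mult_left_mono powr_mono2) (auto simp: field_simps)
    \<comment> \<open>Here -\<alpha> - 1 = -(2 / q), so the ratio splits into the tangent slope at
      \<open>D k\<close> and the left side of the recurrence.\<close>
    also have "\<dots> = \<alpha> * D k powr (-\<alpha> - 1) * (\<mu> * D (Suc k) powr (2 / q))"
      using p by (simp add: powr_divide \<alpha>_def powr_minus field_simps)
    also have "\<dots> \<le> \<alpha> * D k powr (-\<alpha> - 1) * (D k - D (Suc k))"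
      using rec[OF k] \<alpha> by (intro mult_left_mono) auto
    also have "\<dots> \<le> D (Suc k) powr (-\<alpha>) - D k powr (-\<alpha>)"
      using p dec[OF k] \<alpha> by (intro powr_neg_tangent)
    finally show ?thesis .
  next
    case False
    have p: "0 < D k" "0 < D (Suc k)" using pos k by auto
    have "D k powr (-\<alpha>) * 2 powr \<alpha> = (D k / 2) powr (-\<alpha>)"
      using p by (simp add: powr_divide powr_minus field_simps)
    also have "\<dots> \<le> D (Suc k) powr (-\<alpha>)"
      using False p \<alpha> by (intro powr_mono2') auto
    finally have "(2 powr \<alpha> - 1) * D k powr (-\<alpha>) \<le> D (Suc k) powr (-\<alpha>) - D k powr (-\<alpha>)"
      by (simp add: algebra_simps)
    moreover have "D k0 powr (-\<alpha>) \<le> D k powr (-\<alpha>)"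
      using le0[OF k] p \<alpha> by (intro powr_mono2') auto
    then have "(2 powr \<alpha> - 1) * D k0 powr (-\<alpha>) \<le> (2 powr \<alpha> - 1) * D k powr (-\<alpha>)"
      using \<open>1 < 2 powr \<alpha>\<close> by (intro mult_left_mono) auto
    ultimately show ?thesis by (simp add: \<beta>_def)
  qed
  have lin: "\<beta> * real (k - k0) \<le> D k powr (-\<alpha>)" if "k0 \<le> k" for k
    using that
  proof (induction rule: dec_induct)
    case (step k)
    have "real (Suc k - k0) = real (k - k0) + 1" using step by (simp add: Suc_diff_le)
    then have "\<beta> * real (Suc k - k0) = \<beta> * real (k - k0) + \<beta>" by (simp add: algebra_simps)
    then show ?case using step grow[of k] by linarith
  qed auto
  \<comment> \<open>From \<open>2 * k0 + 1\<close> on, \<open>k - k0\<close> is at least half of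
    \<open>k\<close>, which absorbs the shift into \<beta> / 2, and \<open>k\<close> is
    positive.\<close>
  have ev: "norm (D k) \<le> (\<beta> / 2) powr (-1 / \<alpha>) * norm (real k powr (- (q / (2 - q))))"
    if k: "2 * k0 + 1 \<le> k" for k
  proof -
    have p: "0 < D k" using pos k by auto
    have "\<beta> / 2 * real k \<le> \<beta> * real (k - k0)"
      using k \<beta> by (simp add: of_nat_diff)
    also have "\<dots> \<le> D k powr (-\<alpha>)" using k by (intro lin) auto
    finally have "(D k powr (-\<alpha>)) powr (-1 / \<alpha>) \<le> (\<beta> / 2 * real k) powr (-1 / \<alpha>)"
      using k \<beta> \<alpha> by (intro powr_mono2') auto
    moreover have "-1 / \<alpha> = - (q / (2 - q))" using q by (simp add: \<alpha>_def field_simps)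
    moreover have "(\<beta> / 2 * real k) powr (-1 / \<alpha>) = (\<beta> / 2) powr (-1 / \<alpha>) * real k powr (-1 / \<alpha>)"
      using \<beta> by (intro powr_mult)
    moreover have "(D k powr (-\<alpha>)) powr (-1 / \<alpha>) = D k"
      using p \<alpha> by (simp add: powr_powr)
    ultimately show ?thesis using p by simp
  qed
  show ?thesis
    by (rule bigoI, rule eventually_mono[OF eventually_ge_at_top ev])
qed

section \<open>The limiting subdifferential\<close>

text \<open>The difference quotient of \<open>F\<close> lies above that of \<phi>, and the latter
  tends to 0 by differentiability.\<close>

lemma regular_subdiff_smooth_minorant:
  fixes F :: "'a::euclidean_space \<Rightarrow> ereal"
  assumes fin: "\<bar>F x\<bar> \<noteq> \<infinity>"
    and minor: "\<And>y. F x + ereal (\<phi> y - \<phi> x) \<le> F y"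
    and der: "(\<phi> has_derivative (\<lambda>h. s \<bullet> h)) (at x)"
  shows "s \<in> regular_subdiff F x"
proof -
  obtain r where r: "F x = ereal r" using fin by auto
  define Q where "Q y = (\<phi> y - \<phi> x - s \<bullet> (y - x)) / norm (y - x)" for y
  have "(Q \<longlongrightarrow> 0) (at x)"
    using der unfolding has_derivative_def Q_def by (simp add: divide_inverse_commute inner_diff_right netlimit_at)
  then have "((\<lambda>y. ereal (Q y)) \<longlongrightarrow> ereal 0) (at x)" by (rule tendsto_ereal)
  then have "Liminf (at x) (\<lambda>y. ereal (Q y)) = 0"
    by (simp add: lim_imp_Liminf zero_ereal_def)
  moreover have "Liminf (at x) (\<lambda>y. ereal (Q y))
      \<le> Liminf (at x) (\<lambda>y. (F y - F x - ereal (s \<bullet> (y - x))) / ereal (norm (y - x)))"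
  proof (rule Liminf_mono, rule eventually_at_filter[THEN iffD2], rule always_eventually, safe)
    fix y assume "y \<noteq> x"
    then have n: "0 < norm (y - x)" by simp
    show "ereal (Q y) \<le> (F y - F x - ereal (s \<bullet> (y - x))) / ereal (norm (y - x))"
    proof (cases "F y")
      case (real t)
      then have "\<phi> y - \<phi> x \<le> t - r" using minor[of y] r by simp
      then show ?thesis using real r n by (simp add: Q_def divide_right_mono)
    qed (use minor[of y] r n in auto)
  qed
  ultimately show ?thesis using fin by (simp add: regular_subdiff_def)
qed

lemma regular_subset_limiting_subdiff: "regular_subdiff F x \<subseteq> limiting_subdiff F x"
proof
  fix s assume "s \<in> regular_subdiff F x"
  then show "s \<in> limiting_subdiff F x"
    unfolding limiting_subdiff_def mem_Collect_eq
    by (intro conjI exI[of _ "\<lambda>_. x"] exI[of _ "\<lambda>_. s"]) (auto simp: regular_subdiff_def)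
qed

text \<open>Trading sequences for an epsilon condition turns closedness into a triangle inequality,
  with no diagonal sequence. Comparing real parts is faithful because membership in
  \<open>regular_subdiff F y\<close> forces \<open>F y\<close> to be finite.\<close>

lemma limiting_subdiff_iff:
  fixes F :: "'a::real_inner \<Rightarrow> ereal"
  shows "s \<in> limiting_subdiff F x \<longleftrightarrow> \<bar>F x\<bar> \<noteq> \<infinity> \<and>
    (\<forall>e>0. \<exists>y t. t \<in> regular_subdiff F y \<and> dist y x < e \<and>
       \<bar>real_of_ereal (F y) - real_of_ereal (F x)\<bar> < e \<and> dist t s < e)"
  (is "_ \<longleftrightarrow> _ \<and> ?approx")
proof (cases "\<bar>F x\<bar> = \<infinity>")
  case False
  have "?approx" if "s \<in> limiting_subdiff F x"
  proof (intro allI impI)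
    fix e :: real assume e: "0 < e"
    obtain y t where yt: "y \<longlonglongrightarrow> x" "(\<lambda>k. F (y k)) \<longlonglongrightarrow> F x"
      "\<And>k. t k \<in> regular_subdiff F (y k)" "t \<longlonglongrightarrow> s"
      using \<open>s \<in> limiting_subdiff F x\<close> unfolding limiting_subdiff_def by blast
    have "(\<lambda>k. real_of_ereal (F (y k))) \<longlonglongrightarrow> real_of_ereal (F x)"
      using False yt(2) by (intro lim_real_of_ereal) auto
    then have "\<forall>\<^sub>F k in sequentially. dist (real_of_ereal (F (y k))) (real_of_ereal (F x)) < e
        \<and> dist (y k) x < e \<and> dist (t k) s < e"
      using yt e by (intro eventually_conj tendstoD)
    then obtain k where "dist (real_of_ereal (F (y k))) (real_of_ereal (F x)) < e
        \<and> dist (y k) x < e \<and> dist (t k) s < e"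
      using eventually_sequentially by auto
    then show "\<exists>y t. t \<in> regular_subdiff F y \<and> dist y x < e \<and>
       \<bar>real_of_ereal (F y) - real_of_ereal (F x)\<bar> < e \<and> dist t s < e"
      using yt(3) by (auto simp: dist_real_def)
  qed
  moreover have "s \<in> limiting_subdiff F x" if ?approx
  proof -
    have "\<forall>k::nat. \<exists>y t. t \<in> regular_subdiff F y \<and> dist y x < inverse (real (Suc k)) \<and>
       \<bar>real_of_ereal (F y) - real_of_ereal (F x)\<bar> < inverse (real (Suc k)) \<and>
       dist t s < inverse (real (Suc k))"
      using that by simp
    then obtain y t where yt: "\<And>k. t k \<in> regular_subdiff F (y k)"
      "\<And>k. dist (y k) x < inverse (real (Suc k))"
      "\<And>k. dist (real_of_ereal (F (y k))) (real_of_ereal (F x)) < inverse (real (Suc k))"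
      "\<And>k. dist (t k) s < inverse (real (Suc k))"
      unfolding dist_real_def by metis
    have lim: "z \<longlonglongrightarrow> l" if "\<And>k. dist (z k) l < inverse (real (Suc k))"
      for z :: "nat \<Rightarrow> 'b::metric_space" and l
      using tendsto_sandwich[OF _ _ tendsto_const LIMSEQ_inverse_real_of_nat, of "\<lambda>k. dist (z k) l"]
        that by (subst tendsto_dist_iff) (auto intro: always_eventually less_imp_le)
    have "(\<lambda>k. ereal (real_of_ereal (F (y k)))) \<longlonglongrightarrow> ereal (real_of_ereal (F x))"
      using lim[OF yt(3)] by (rule tendsto_ereal)
    moreover have "\<bar>F (y k)\<bar> \<noteq> \<infinity>" for k using yt(1)[of k] by (simp add: regular_subdiff_def)
    ultimately have "(\<lambda>k. F (y k)) \<longlonglongrightarrow> F x"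
      using False by (simp add: ereal_real)
    then show ?thesis
      unfolding limiting_subdiff_def using False yt(1) lim[OF yt(2)] lim[OF yt(4)] by auto
  qed
  ultimately show ?thesis using False by blast
qed (simp add: limiting_subdiff_def)

lemma closed_limiting_subdiff:
  fixes F :: "'a::real_inner \<Rightarrow> ereal"
  shows "closed (limiting_subdiff F x)"
  unfolding closed_sequential_limits
proof safe
  fix u s assume u: "\<forall>n. u n \<in> limiting_subdiff F x" and lim: "u \<longlonglongrightarrow> s"
  have "\<exists>y t. t \<in> regular_subdiff F y \<and> dist y x < e \<and>
       \<bar>real_of_ereal (F y) - real_of_ereal (F x)\<bar> < e \<and> dist t s < e" if e: "0 < e" for e
  proof -
    obtain n where n: "dist (u n) s < e / 2"
      using tendstoD[OF lim, of "e / 2"] e eventually_sequentially by auto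
    obtain y t where yt: "t \<in> regular_subdiff F y" "dist y x < e / 2"
       "\<bar>real_of_ereal (F y) - real_of_ereal (F x)\<bar> < e / 2" "dist t (u n) < e / 2"
      using u e unfolding limiting_subdiff_iff by (meson half_gt_zero)
    have "dist t s < e" using yt(4) n dist_triangle_half_l[of t "u n" e s] by (simp add: dist_commute)
    then show ?thesis using yt e by (intro exI[of _ y] exI[of _ t]) auto
  qed
  then show "s \<in> limiting_subdiff F x" using u by (auto simp: limiting_subdiff_iff)
qed

text \<open>A nonempty closed set in a Euclidean space has a point nearest to 0; this makes the
  minimum over subgradients in the theorem an attained one.\<close>

lemma limiting_subdiff_least_norm:
  fixes F :: "'a::euclidean_space \<Rightarrow> ereal"
  assumes "s \<in> limiting_subdiff F x"
  obtains m where "is_arg_min norm (\<lambda>s. s \<in> limiting_subdiff F x) m" "norm m \<le> norm s"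
proof -
  obtain m where "m \<in> limiting_subdiff F x" "\<And>y. y \<in> limiting_subdiff F x \<Longrightarrow> dist 0 m \<le> dist 0 y"
    using distance_attains_inf[OF closed_limiting_subdiff, of F x 0] assms by blast
  then show thesis using that[of m] assms by (auto simp: is_arg_min_def not_less)
qed

text \<open>The second derivative is bounded on the compact ball, and the mean value inequality
  applies since the ball is convex. A single \<open>D\<close> serves all radii; only
  \<open>L\<close> depends on \<open>R\<close>.\<close>

lemma C2_derivative_lipschitz_on_cball:
  fixes f :: "'a::euclidean_space \<Rightarrow> real"
  assumes "C2 f"
  shows "\<exists>D. (\<forall>x. (f has_derivative blinfun_apply (D x)) (at x)) \<and>
    (\<forall>R. \<exists>L\<ge>0. \<forall>y\<in>cball 0 R. \<forall>z\<in>cball 0 R. norm (D y - D z) \<le> L * norm (y - z))"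
proof -
  obtain D D2 where D: "\<And>x. (f has_derivative blinfun_apply (D x)) (at x)"
    and D2: "\<And>x. (D has_derivative blinfun_apply (D2 x)) (at x)"
    and cont: "continuous_on UNIV D2"
    using assms unfolding C2_def by blast
  have "\<exists>L\<ge>0. \<forall>y\<in>cball 0 R. \<forall>z\<in>cball 0 R. norm (D y - D z) \<le> L * norm (y - z)" for R
  proof -
    have "bounded (D2 ` cball 0 R)"
      using cont by (intro compact_imp_bounded compact_continuous_image)
        (auto intro: continuous_on_subset)
    then obtain L where L: "0 < L" "\<And>y. y \<in> cball 0 R \<Longrightarrow> norm (D2 y) \<le> L"
      unfolding bounded_pos by blast
    have "norm (D y - D z) \<le> L * norm (y - z)" if "y \<in> cball 0 R" "z \<in> cball 0 R" for y z
      using that L(2)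
      by (intro differentiable_bound[where S = "cball 0 R" and f' = "\<lambda>x. blinfun_apply (D2 x)"])
        (auto intro: has_derivative_at_withinI[OF D2] simp flip: norm_blinfun.rep_eq)
    then show ?thesis using L(1) by (intro exI[of _ L]) auto
  qed
  then show ?thesis using D by blast
qed

section \<open>Block projections\<close>

text \<open>The orthogonal projection \<open>E_i E_i^T\<close>. It keeps all computations in
  \<open>real ^ 'n\<close> rather than in block spaces of varying dimension.\<close>

definition block_proj ::
  "(nat \<Rightarrow> nat) \<Rightarrow> (nat \<Rightarrow> nat \<Rightarrow> 'n::finite) \<Rightarrow> nat \<Rightarrow> real ^ 'n \<Rightarrow> real ^ 'n" where
  "block_proj d c i x = embed d c i (block d c x i)"

lemma block_in_Rspace: "block d c x i \<in> Rspace (d i)"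
  by (simp add: block_def topspace_Euclidean_space)

lemma bounded_linear_block_proj: "bounded_linear (block_proj d c i)"
  unfolding block_proj_def embed_def block_def
  by (intro bounded_linear_sum bounded_linear_scaleR_const) (simp add: bounded_linear_vec_nth)

lemma linear_block_proj: "linear (block_proj d c i)"
  using bounded_linear_block_proj bounded_linear.linear by blast

context
  fixes N :: nat and d :: "nat \<Rightarrow> nat" and c :: "nat \<Rightarrow> nat \<Rightarrow> 'n::finite"
  assumes blocks: "block_structure N d c"
begin

lemma block_index_inj:
  assumes "i \<in> {1..N}" "l < d i" "j \<in> {1..N}" "m < d j"
  shows "c i l = c j m \<longleftrightarrow> i = j \<and> l = m"
proof -
  have "inj_on (\<lambda>(i, l). c i l) (SIGMA i:{1..N}. {..<d i})"
    using blocks unfolding block_structure_def bij_betw_def by blast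
  from inj_onD[OF this, of "(i, l)" "(j, m)"] show ?thesis using assms by auto
qed

lemma block_index_cases:
  obtains i l where "i \<in> {1..N}" "l < d i" "k = c i l"
proof -
  have "k \<in> (\<lambda>(i, l). c i l) ` (SIGMA i:{1..N}. {..<d i})"
    using blocks unfolding block_structure_def bij_betw_def by blast
  then show thesis using that by auto
qed

text \<open>The type \<open>'n\<close> has an element, and that coordinate lies in some block; hence
  the minimum of the \<open>M i\<close> is over a nonempty set.\<close>

lemma blocks_nonempty: "1 \<le> N"
proof -
  obtain i l where "i \<in> {1..N}" "(undefined::'n) = c i l" by (rule block_index_cases)
  then show ?thesis by simp
qed

lemma sum_block_index: "(\<Sum>k\<in>UNIV. h k) = (\<Sum>i=1..N. \<Sum>l<d i. h (c i l))"
proof -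
  have "(\<Sum>i=1..N. \<Sum>l<d i. h (c i l)) = (\<Sum>(i, l)\<in>(SIGMA i:{1..N}. {..<d i}). h (c i l))"
    by (rule sum.Sigma) auto
  also have "\<dots> = (\<Sum>k\<in>UNIV. h k)"
    using sum.reindex_bij_betw[OF blocks[unfolded block_structure_def], of h]
    by (simp add: case_prod_unfold)
  finally show ?thesis by simp
qed

lemma embed_component:
  assumes "i \<in> {1..N}" "j \<in> {1..N}" "l < d j"
  shows "embed d c i v $ c j l = (if i = j then v l else 0)"
proof -
  have "embed d c i v $ c j l = (\<Sum>m<d i. v m * (if c j l = c i m then 1 else 0))"
    by (simp add: embed_def axis_def)
  also have "\<dots> = (\<Sum>m<d i. if i = j \<and> m = l then v m else 0)"
    using block_index_inj assms by (intro sum.cong) auto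
  also have "\<dots> = (if i = j then v l else 0)" using assms by (simp add: sum.delta)
  finally show ?thesis .
qed

lemma norm_embed:
  assumes i: "i \<in> {1..N}"
  shows "norm (embed d c i v) = Rnorm (d i) v"
proof -
  have "(\<Sum>k\<in>UNIV. (norm (embed d c i v $ k))\<^sup>2)
      = (\<Sum>j=1..N. \<Sum>l<d j. if i = j then (v l)\<^sup>2 else 0)"
    unfolding sum_block_index using i by (intro sum.cong) (auto simp: embed_component)
  also have "\<dots> = (\<Sum>j=1..N. if i = j then (\<Sum>l<d j. (v l)\<^sup>2) else 0)"
    by (intro sum.cong) auto
  also have "\<dots> = (\<Sum>l<d i. (v l)\<^sup>2)" using i by simp
  finally show ?thesis by (simp add: norm_vec_def Rnorm_def L2_set_def)
qed

lemma Rnorm_block_diff: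
  assumes "i \<in> {1..N}"
  shows "Rnorm (d i) (\<lambda>l. block d c y i l - block d c z i l) = norm (block_proj d c i (y - z))"
proof -
  have "(\<lambda>l. block d c y i l - block d c z i l) = block d c (y - z) i"
    by (auto simp: block_def)
  then show ?thesis using assms by (simp add: block_proj_def norm_embed)
qed

lemma sum_block_proj: "(\<Sum>i=1..N. block_proj d c i x) = x"
proof (rule vec_eq_iff[THEN iffD2], rule allI)
  fix k obtain j l where jl: "j \<in> {1..N}" "l < d j" "k = c j l" by (rule block_index_cases)
  have "(\<Sum>i=1..N. block_proj d c i x) $ k = (\<Sum>i=1..N. if i = j then x $ k else 0)"
    unfolding sum_component using jl
    by (intro sum.cong) (auto simp: block_proj_def embed_component block_def)
  then show "(\<Sum>i=1..N. block_proj d c i x) $ k = x $ k" using jl by simp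
qed

text \<open>Pythagoras over the blocks; it merges the proximal terms of one sweep into the squared
  length of the full step.\<close>

lemma norm_sum_block_proj: "(norm x)\<^sup>2 = (\<Sum>i=1..N. (norm (block_proj d c i x))\<^sup>2)"
proof -
  have "(norm x)\<^sup>2 = (\<Sum>k\<in>UNIV. (x $ k)\<^sup>2)"
    by (simp add: norm_vec_def L2_set_def sum_nonneg)
  also have "\<dots> = (\<Sum>i=1..N. \<Sum>l<d i. (x $ c i l)\<^sup>2)" by (rule sum_block_index)
  also have "\<dots> = (\<Sum>i=1..N. (norm (block_proj d c i x))\<^sup>2)"
    by (intro sum.cong) (auto simp: block_proj_def norm_embed Rnorm_def L2_set_def block_def sum_nonneg)
  finally show ?thesis .
qed

lemma norm_block_proj_le:
  assumes "i \<in> {1..N}"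
  shows "norm (block_proj d c i x) \<le> norm x"
proof -
  have "(norm (block_proj d c i x))\<^sup>2 \<le> (norm x)\<^sup>2"
    unfolding norm_sum_block_proj[of x] using assms by (intro member_le_sum) auto
  then show ?thesis by (rule power2_le_imp_le) simp
qed

end

section \<open>The RCCM iteration\<close>

text \<open>The point reached after the first \<open>i\<close> block updates of sweep \<open>k\<close>:
  \<open>(x\<^sub>k\<^sub>+\<^sub>1\<^sup>(\<^sup>1\<^sup>), \<dots>, x\<^sub>k\<^sub>+\<^sub>1\<^sup>(\<^sup>i\<^sup>), x\<^sub>k\<^sup>(\<^sup>i\<^sup>+\<^sup>1\<^sup>), \<dots>, x\<^sub>k\<^sup>(\<^sup>N\<^sup>))\<close>.\<close>

definition partial_iterate ::
  "nat \<Rightarrow> (nat \<Rightarrow> nat) \<Rightarrow> (nat \<Rightarrow> nat \<Rightarrow> 'n::finite) \<Rightarrow> (nat \<Rightarrow> real ^ 'n) \<Rightarrow> nat \<Rightarrow> nat \<Rightarrow> real ^ 'n" where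
  "partial_iterate N d c x k i =
     (\<Sum>j=1..N. block_proj d c j (if j \<le> i then x (Suc k) else x k))"

context
  fixes N :: nat and d :: "nat \<Rightarrow> nat" and c :: "nat \<Rightarrow> nat \<Rightarrow> 'n::finite"
    and f :: "real ^ 'n \<Rightarrow> real" and g :: "real ^ 'n \<Rightarrow> ereal"
    and gs :: "nat \<Rightarrow> (nat \<Rightarrow> real) \<Rightarrow> ereal"
    and M :: "nat \<Rightarrow> real" and x :: "nat \<Rightarrow> real ^ 'n"
  assumes blocks: "block_structure N d c"
    and A1i: "assumption1_i N d c f g gs"
    and alg: "RCCM N d c f g gs M x"
begin

abbreviation (input) "P \<equiv> block_proj d c"
abbreviation (input) "w \<equiv> partial_iterate N d c x"

section \<open>Partial iterates within a sweep\<close>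

lemma partial_iterate_0: "w k 0 = x k"
proof -
  have "w k 0 = (\<Sum>j=1..N. P j (x k))"
    unfolding partial_iterate_def
  proof (rule sum.cong)
    fix j assume "j \<in> {1..N}"
    then have "\<not> j \<le> 0" by simp
    then show "P j (if j \<le> 0 then x (Suc k) else x k) = P j (x k)" by (simp only: if_False)
  qed simp
  then show ?thesis by (simp only: sum_block_proj[OF blocks])
qed

lemma partial_iterate_N: "w k N = x (Suc k)"
proof -
  have "w k N = (\<Sum>j=1..N. P j (x (Suc k)))" unfolding partial_iterate_def by (intro sum.cong) auto
  then show ?thesis by (simp only: sum_block_proj[OF blocks])
qed

text \<open>Since \<open>w k i\<close> already carries the new \<open>i\<close>-th block, a
  competitor taken from \<open>y\<close> becomes a displacement that vanishes at the minimiser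
  \<open>y = x (Suc k)\<close>.\<close>

lemma assemble_xhat:
  assumes i: "i \<in> {1..N}"
  shows "assemble N d c ((xhat d c x k i)(i := block d c y i)) = w k i + P i (y - x (Suc k))"
proof -
  have "assemble N d c ((xhat d c x k i)(i := block d c y i))
      = (\<Sum>j=1..N. P j (if j \<le> i then x (Suc k) else x k) + (if j = i then P i (y - x (Suc k)) else 0))"
    unfolding assemble_def
    by (intro sum.cong) (auto simp: xhat_def block_proj_def[symmetric] linear_diff[OF linear_block_proj])
  also have "\<dots> = w k i + P i (y - x (Suc k))"
    using i by (simp add: partial_iterate_def sum.distrib)
  finally show ?thesis .
qed

text \<open>Undoing the \<open>i\<close>-th update: testing the subproblem with the old block
  compares consecutive partial iterates, so that the values of \<open>f\<close> telescope.\<close>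

lemma partial_iterate_pred:
  assumes i: "i \<in> {1..N}"
  shows "w k i + P i (x k - x (Suc k)) = w k (i - 1)"
proof -
  have "w k (i - 1)
      = (\<Sum>j=1..N. P j (if j \<le> i then x (Suc k) else x k) + (if j = i then P i (x k - x (Suc k)) else 0))"
    unfolding partial_iterate_def
    by (intro sum.cong) (auto simp: linear_diff[OF linear_block_proj])
  also have "\<dots> = w k i + P i (x k - x (Suc k))"
    using i by (simp add: partial_iterate_def sum.distrib)
  finally show ?thesis by simp
qed

lemma norm_partial_iterate_diff_le: "norm (x (Suc k) - w k i) \<le> N * norm (x (Suc k) - x k)"
proof -
  have "x (Suc k) - w k i
      = (\<Sum>j=1..N. P j (x (Suc k)) - P j (if j \<le> i then x (Suc k) else x k))"
    unfolding partial_iterate_def sum_subtractf sum_block_proj[OF blocks] ..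
  also have "norm \<dots> \<le> of_nat (card {1..N}) * norm (x (Suc k) - x k)"
    by (rule sum_norm_bound)
      (auto simp: linear_diff[OF linear_block_proj, symmetric] linear_0[OF linear_block_proj]
        intro: norm_block_proj_le[OF blocks])
  finally show ?thesis by simp
qed

text \<open>The subproblem's optimality moved to \<open>real ^ 'n\<close>. The choice
  \<open>y = x k\<close> yields finiteness and descent; arbitrary \<open>y\<close> yields the
  minorant.\<close>

lemma block_minimal:
  assumes i: "i \<in> {1..N}"
  shows "ereal (f (w k i)) + gs i (block d c (x (Suc k)) i)
           + ereal (M i / 2 * (norm (P i (x (Suc k) - x k)))\<^sup>2)
         \<le> ereal (f (w k i + P i (y - x (Suc k)))) + gs i (block d c y i)
           + ereal (M i / 2 * (norm (P i (y - x k)))\<^sup>2)"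
proof -
  have "is_arg_min
          (\<lambda>v. ereal (f (assemble N d c ((xhat d c x k i)(i := v)))) + gs i v
               + ereal (M i / 2 * (Rnorm (d i) (\<lambda>l. v l - block d c (x k) i l))\<^sup>2))
          (\<lambda>v. v \<in> Rspace (d i)) (block d c (x (Suc k)) i)"
    using alg i unfolding RCCM_def by blast
  from is_arg_min_linorder[THEN iffD1, OF this] block_in_Rspace[of d c y i]
  have "ereal (f (assemble N d c ((xhat d c x k i)(i := block d c (x (Suc k)) i))))
      + gs i (block d c (x (Suc k)) i)
      + ereal (M i / 2 * (Rnorm (d i) (\<lambda>l. block d c (x (Suc k)) i l - block d c (x k) i l))\<^sup>2)
    \<le> ereal (f (assemble N d c ((xhat d c x k i)(i := block d c y i)))) + gs i (block d c y i)
      + ereal (M i / 2 * (Rnorm (d i) (\<lambda>l. block d c y i l - block d c (x k) i l))\<^sup>2)"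
    by blast
  then show ?thesis
    unfolding assemble_xhat[OF i] Rnorm_block_diff[OF blocks i]
    by (simp add: linear_0[OF linear_block_proj])
qed

section \<open>Finite values along the iterates and sufficient decrease\<close>

lemma gs_not_MInf: "i \<in> {1..N} \<Longrightarrow> gs i (block d c y i) \<noteq> -\<infinity>"
  using A1i block_in_Rspace unfolding assumption1_i_def by blast

lemma g_eq: "g y = (\<Sum>i=1..N. gs i (block d c y i))"
  using A1i unfolding assumption1_i_def by blast

text \<open>Finiteness passes from sweep to sweep because the old block is an admissible competitor
  with a finite subproblem value.\<close>

lemma gs_finite:
  assumes i: "i \<in> {1..N}"
  shows "\<bar>gs i (block d c (x k) i)\<bar> \<noteq> \<infinity>"
proof (induction k)
  case 0
  have "g (x 0) \<noteq> \<infinity>" using alg by (simp add: RCCM_def)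
  then have "gs i (block d c (x 0) i) \<noteq> \<infinity>" using i by (simp add: g_eq sum_Pinfty)
  then show ?case using gs_not_MInf[OF i] by auto
next
  case (Suc k)
  then have "gs i (block d c (x (Suc k)) i) \<noteq> \<infinity>"
    using block_minimal[OF i, of k "x k"] by auto
  then show ?case using gs_not_MInf[OF i] by auto
qed

definition gs_val :: "nat \<Rightarrow> nat \<Rightarrow> real" where
  "gs_val k i = real_of_ereal (gs i (block d c (x k) i))"

lemma gs_eq_gs_val: "i \<in> {1..N} \<Longrightarrow> gs i (block d c (x k) i) = ereal (gs_val k i)"
  using gs_finite by (simp add: gs_val_def ereal_real)

lemma objective_real: "objective f g (x k) = ereal (f (x k) + (\<Sum>i=1..N. gs_val k i))"
proof -
  have "g (x k) = (\<Sum>i=1..N. ereal (gs_val k i))" unfolding g_eq by (intro sum.cong) (auto simp: gs_eq_gs_val)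
  then show ?thesis by (simp add: objective_def)
qed

lemma descent:
  assumes m: "\<And>i. i \<in> {1..N} \<Longrightarrow> m \<le> M i"
  shows "real_of_ereal (objective f g (x (Suc k))) + m / 2 * (norm (x (Suc k) - x k))\<^sup>2
       \<le> real_of_ereal (objective f g (x k))"
proof -
  have "f (w k i) - f (w k (i - 1)) + m / 2 * (norm (P i (x (Suc k) - x k)))\<^sup>2 \<le> gs_val k i - gs_val (Suc k) i"
    if i: "i \<in> {1..N}" for i
  proof -
    have "f (w k i) + gs_val (Suc k) i + M i / 2 * (norm (P i (x (Suc k) - x k)))\<^sup>2
        \<le> f (w k (i - 1)) + gs_val k i"
      using block_minimal[OF i, of k "x k"]
      by (simp add: partial_iterate_pred[OF i] gs_eq_gs_val[OF i] linear_0[OF linear_block_proj])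
    moreover have "m / 2 * (norm (P i (x (Suc k) - x k)))\<^sup>2 \<le> M i / 2 * (norm (P i (x (Suc k) - x k)))\<^sup>2"
      using m[OF i] by (intro mult_right_mono) auto
    ultimately show ?thesis by simp
  qed
  then have "(\<Sum>i=1..N. f (w k i) - f (w k (i - 1)) + m / 2 * (norm (P i (x (Suc k) - x k)))\<^sup>2)
      \<le> (\<Sum>i=1..N. gs_val k i - gs_val (Suc k) i)"
    by (intro sum_mono) auto
  \<comment> \<open>Telescoping over the blocks runs from \<open>w k 0 = x k\<close> to
    \<open>w k N = x (Suc k)\<close>.\<close>
  moreover have "(\<Sum>i=1..N. f (w k i) - f (w k (i - 1))) = f (x (Suc k)) - f (x k)"
    using sum_telescope''[of 0 N "\<lambda>i. f (w k i)"] by (simp add: partial_iterate_0 partial_iterate_N atLeastSucAtMost_greaterThanAtMost[symmetric])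
  ultimately show ?thesis
    unfolding objective_real norm_sum_block_proj[OF blocks, of "x (Suc k) - x k"]
    by (simp add: sum.distrib sum_subtractf sum_distrib_left)
qed

text \<open>Adding the minimality inequalities of the \<open>N\<close> block subproblems that produced \<open>x (Suc k)\<close>,
  each tested against the corresponding block of \<open>y\<close>, bounds \<open>g y\<close> from below by a smooth function
  of \<open>y\<close>; adding \<open>f y\<close> gives this minorant of \<open>F\<close>, up to a constant.\<close>

definition minorant :: "nat \<Rightarrow> real ^ 'n \<Rightarrow> real" where
  "minorant k y = f y - (\<Sum>i=1..N. f (w k i + P i (y - x (Suc k)))
                        + M i / 2 * (norm (P i (y - x k)))\<^sup>2)"

lemma objective_ge_minorant:
  "objective f g (x (Suc k)) + ereal (minorant k y - minorant k (x (Suc k))) \<le> objective f g y"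
proof (cases "g y = \<infinity>")
  case False
  have fin: "\<bar>gs i (block d c y i)\<bar> \<noteq> \<infinity>" if "i \<in> {1..N}" for i
    using False gs_not_MInf[OF that, of y] that by (auto simp: g_eq sum_Pinfty)
  define G where "G i = real_of_ereal (gs i (block d c y i))" for i
  have G: "gs i (block d c y i) = ereal (G i)" if "i \<in> {1..N}" for i
    using fin[OF that] by (simp add: G_def ereal_real)
  have "f (w k i) + M i / 2 * (norm (P i (x (Suc k) - x k)))\<^sup>2
        - (f (w k i + P i (y - x (Suc k))) + M i / 2 * (norm (P i (y - x k)))\<^sup>2)
      \<le> G i - gs_val (Suc k) i" if i: "i \<in> {1..N}" for i
    using block_minimal[OF i, of k y] by (simp add: gs_eq_gs_val[OF i] G[OF i])
  then have "(\<Sum>i=1..N. f (w k i) + M i / 2 * (norm (P i (x (Suc k) - x k)))\<^sup>2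
        - (f (w k i + P i (y - x (Suc k))) + M i / 2 * (norm (P i (y - x k)))\<^sup>2))
      \<le> (\<Sum>i=1..N. G i - gs_val (Suc k) i)"
    by (intro sum_mono) auto
  then have "f (x (Suc k)) + (\<Sum>i=1..N. gs_val (Suc k) i) + (minorant k y - minorant k (x (Suc k)))
      \<le> f y + (\<Sum>i=1..N. G i)"
    by (simp add: minorant_def sum_subtractf linear_0[OF linear_block_proj])
  moreover have "objective f g y = ereal (f y + (\<Sum>i=1..N. G i))"
  proof -
    have "g y = (\<Sum>i=1..N. ereal (G i))" unfolding g_eq by (intro sum.cong) (auto simp: G)
    then show ?thesis by (simp add: objective_def)
  qed
  ultimately show ?thesis by (simp add: objective_real)
qed (simp add: objective_def)

lemma minorant_derivative:
  assumes D: "\<And>x. (f has_derivative blinfun_apply (D x)) (at x)"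
  shows "(minorant k has_derivative
    (\<lambda>h. \<Sum>i=1..N. blinfun_apply (D (x (Suc k)) - D (w k i)) (P i h)
            - M i * (P i (x (Suc k) - x k) \<bullet> P i h))) (at (x (Suc k)))"
proof -
  have P: "(P i has_derivative P i) F" for i F
    by (rule bounded_linear_imp_has_derivative[OF bounded_linear_block_proj])
  have aff: "((\<lambda>y. P i (y - a)) has_derivative P i) (at z)" for i a z
  proof -
    have "((\<lambda>y. P i y - P i a) has_derivative (\<lambda>h. P i h - 0)) (at z)"
      by (intro has_derivative_diff P has_derivative_const)
    then show ?thesis by (simp add: linear_diff[OF linear_block_proj])
  qed
  have 1: "((\<lambda>y. f (w k i + P i (y - x (Suc k)))) has_derivative (\<lambda>h. blinfun_apply (D (w k i)) (P i h)))
     (at (x (Suc k)))" for i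
  proof -
    have "((\<lambda>y. w k i + P i (y - x (Suc k))) has_derivative P i) (at (x (Suc k)))"
      using has_derivative_add[OF has_derivative_const aff] by simp
    moreover have "(f has_derivative blinfun_apply (D (w k i)))
        (at (w k i + P i (x (Suc k) - x (Suc k))))"
      using D by (simp add: linear_0[OF linear_block_proj])
    ultimately show ?thesis by (rule has_derivative_compose)
  qed
  have 2: "((\<lambda>y. M i / 2 * (norm (P i (y - x k)))\<^sup>2) has_derivative
       (\<lambda>h. M i * (P i (x (Suc k) - x k) \<bullet> P i h))) (at (x (Suc k)))" for i
    unfolding power2_norm_eq_inner
    by (rule derivative_eq_intros aff refl)+ (auto simp: inner_commute)
  have "(minorant k has_derivative (\<lambda>h. blinfun_apply (D (x (Suc k))) h
      - (\<Sum>i=1..N. blinfun_apply (D (w k i)) (P i h) + M i * (P i (x (Suc k) - x k) \<bullet> P i h))))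
      (at (x (Suc k)))"
    unfolding minorant_def
    by (intro has_derivative_diff D has_derivative_sum has_derivative_add 1 2)
  \<comment> \<open>Splitting \<open>h\<close> into its blocks pairs the derivative at
    \<open>x (Suc k)\<close> with the one at each \<open>w k i\<close>; only their differences
    remain, and these are small by the Lipschitz bound.\<close>
  moreover have "blinfun_apply (D (x (Suc k))) h
      - (\<Sum>i=1..N. blinfun_apply (D (w k i)) (P i h) + M i * (P i (x (Suc k) - x k) \<bullet> P i h))
    = (\<Sum>i=1..N. blinfun_apply (D (x (Suc k)) - D (w k i)) (P i h)
            - M i * (P i (x (Suc k) - x k) \<bullet> P i h))" for h
  proof -
    have "blinfun_apply (D (x (Suc k))) h = (\<Sum>i=1..N. blinfun_apply (D (x (Suc k))) (P i h))"
      by (simp only: blinfun.sum_right[symmetric] sum_block_proj[OF blocks])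
    then show ?thesis by (simp add: sum_subtractf[symmetric] blinfun.diff_left diff_diff_eq)
  qed
  ultimately show ?thesis by (simp only:)
qed

section \<open>Subgradients bounded by the step length\<close>

lemma subgradient_bound:
  assumes "bounded (range x)"
  shows "\<exists>C>0. \<forall>k. \<exists>s\<in>limiting_subdiff (objective f g) (x (Suc k)).
    norm s \<le> C * norm (x (Suc k) - x k)"
proof -
  have "C2 f" using A1i unfolding assumption1_i_def by blast
  obtain D where D: "\<And>x. (f has_derivative blinfun_apply (D x)) (at x)"
    and lip: "\<And>R. \<exists>L\<ge>0. \<forall>y\<in>cball 0 R. \<forall>z\<in>cball 0 R. norm (D y - D z) \<le> L * norm (y - z)"
    using C2_derivative_lipschitz_on_cball[OF \<open>C2 f\<close>] by blast
  obtain B where B: "0 < B" "\<And>k. norm (x k) \<le> B"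
    using assms unfolding bounded_pos by auto
  \<comment> \<open>A ball containing all iterates and all partial iterates: a step has length at
    most \<open>B + B\<close>, and a partial iterate is within \<open>N\<close> step lengths of
    \<open>x (Suc k)\<close>.\<close>
  define R where "R = N * (B + B) + B"
  obtain L where L: "0 \<le> L" "\<And>y z. norm y \<le> R \<Longrightarrow> norm z \<le> R \<Longrightarrow> norm (D y - D z) \<le> L * norm (y - z)"
    using lip[of R] by auto
  have xR: "norm (x k) \<le> R" for k
    using B(2)[of k] B(1) by (simp add: R_def add_increasing)
  have wR: "norm (w k i) \<le> R" for k i
  proof -
    have "norm (x (Suc k) - x k) \<le> B + B"
      using norm_triangle_ineq4 B(2) by (meson add_mono order_trans)
    then have "norm (x (Suc k) - w k i) \<le> N * (B + B)"
      using norm_partial_iterate_diff_le[of k i] by (meson mult_left_mono of_nat_0_le_iff order_trans)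
    then show ?thesis
      using norm_triangle_sub[of "w k i" "x (Suc k)"] B(2)[of "Suc k"]
      by (simp add: R_def norm_minus_commute)
  qed
  have M0: "0 \<le> M i" if "i \<in> {1..N}" for i using alg that unfolding RCCM_def by blast
  \<comment> \<open>Block \<open>i\<close> contributes \<open>L * N\<close> through the derivative
    difference and \<open>M i\<close> through the proximal term; the final 1 secures
    positivity.\<close>
  define C where "C = (\<Sum>i=1..N. L * N + M i) + 1"
  have C: "0 < C" unfolding C_def using L(1) M0 by (intro add_nonneg_pos sum_nonneg) auto
  have "\<exists>s\<in>limiting_subdiff (objective f g) (x (Suc k)). norm s \<le> C * norm (x (Suc k) - x k)" for k
  proof -
    define \<phi>' where "\<phi>' h = (\<Sum>i=1..N. blinfun_apply (D (x (Suc k)) - D (w k i)) (P i h)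
            - M i * (P i (x (Suc k) - x k) \<bullet> P i h))" for h
    have der: "(minorant k has_derivative \<phi>') (at (x (Suc k)))"
      using minorant_derivative[OF D] by (simp add: \<phi>'_def[abs_def])
    \<comment> \<open>The Riesz representative of the functional \<phi>', that is, the gradient of
      the minorant.\<close>
    define s where "s = adjoint \<phi>' 1"
    have s: "\<phi>' h = s \<bullet> h" for h
      using adjoint_works[OF has_derivative_linear[OF der], of h 1]
      by (simp add: s_def inner_commute)
    let ?r = "norm (x (Suc k) - x k)"
    have "\<phi>' h \<le> (\<Sum>i=1..N. (L * N + M i) * ?r * norm h)" for h
      unfolding \<phi>'_def
    proof (rule sum_mono)
      fix i assume i: "i \<in> {1..N}"
      have "norm (D (x (Suc k)) - D (w k i)) \<le> L * (N * ?r)"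
        using L(2)[OF xR wR] norm_partial_iterate_diff_le[of k i] L(1) by (meson mult_left_mono order_trans)
      then have "blinfun_apply (D (x (Suc k)) - D (w k i)) (P i h) \<le> L * (N * ?r) * norm h"
        using norm_blinfun[of "D (x (Suc k)) - D (w k i)" "P i h"] norm_block_proj_le[OF blocks i, of h]
        by (smt (verit) mult_mono norm_ge_zero real_norm_def)
      moreover have "\<bar>P i (x (Suc k) - x k) \<bullet> P i h\<bar> \<le> ?r * norm h"
        using Cauchy_Schwarz_ineq2 norm_block_proj_le[OF blocks i]
        by (meson mult_mono norm_ge_zero order_trans)
      then have "M i * - (P i (x (Suc k) - x k) \<bullet> P i h) \<le> M i * (?r * norm h)"
        using M0[OF i] by (intro mult_left_mono) auto
      ultimately show "blinfun_apply (D (x (Suc k)) - D (w k i)) (P i h)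
          - M i * (P i (x (Suc k) - x k) \<bullet> P i h) \<le> (L * N + M i) * ?r * norm h"
        by (simp add: algebra_simps)
    qed
    also have "(\<Sum>i=1..N. (L * N + M i) * ?r * norm h) \<le> C * ?r * norm h" for h
      unfolding C_def sum_distrib_right[symmetric] by (intro mult_right_mono) auto
    \<comment> \<open>The bound holds for every direction \<open>h\<close>; taking
      \<open>h = s\<close> turns it into a bound on the norm of \<open>s\<close>.\<close>
    finally have "s \<bullet> s \<le> C * ?r * norm s" by (simp add: s)
    then have "norm s * norm s \<le> (C * ?r) * norm s" by (simp add: dot_square_norm power2_eq_square)
    then have "norm s \<le> C * ?r" using C by (cases "s = 0") auto
    moreover have "s \<in> regular_subdiff (objective f g) (x (Suc k))"
      by (rule regular_subdiff_smooth_minorant[where \<phi> = "minorant k"])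
        (use objective_ge_minorant[of k] der in \<open>auto simp: objective_real s[abs_def]\<close>)
    then have "s \<in> limiting_subdiff (objective f g) (x (Suc k))"
      using regular_subset_limiting_subdiff by blast
    ultimately show ?thesis by blast
  qed
  then show ?thesis using C by blast
qed

end

section \<open>Convergence rates\<close>

text \<open>The subgradient \<open>s\<close> shows that the subdifferential is nonempty, as
  \<open>KL_property\<close> demands, and bounds its distance to 0 by \<open>C * r\<close>. The
  power \<open>2 / q\<close> then turns the \<open>q\<close>-th power of \<open>C * r\<close> into
  the square that the descent estimate controls.\<close>

lemma KL_step:
  assumes KL: "KL_property F X Fstar \<sigma> q \<gamma> \<epsilon>"
    and near: "infdist y X \<le> \<gamma>" "ereal Fstar < F y" "F y < ereal (Fstar + \<epsilon>)"
    and s: "s \<in> limiting_subdiff F y" "norm s \<le> C * r" and C: "0 < C" and r: "0 \<le> r"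
  shows "(real_of_ereal (F y) - Fstar) powr (2 / q) \<le> C\<^sup>2 * \<sigma> powr (2 / q) * r\<^sup>2"
proof -
  have q: "1 < q" and \<sigma>: "0 < \<sigma>" using KL by (auto simp: KL_property_def)
  have "F y - ereal Fstar \<le> ereal (\<sigma> * infdist 0 (limiting_subdiff F y) powr q)"
    using KL near s unfolding KL_property_def by blast
  moreover obtain t where t: "F y = ereal t" using near by (cases "F y") auto
  ultimately have "t - Fstar \<le> \<sigma> * infdist 0 (limiting_subdiff F y) powr q" by simp
  also have "\<dots> \<le> \<sigma> * (C * r) powr q"
    using infdist_le[OF s(1), of 0] s(2) q \<sigma>
    by (intro mult_left_mono powr_mono2) (auto simp: infdist_nonneg)
  finally have "(t - Fstar) powr (2 / q) \<le> (\<sigma> * (C * r) powr q) powr (2 / q)"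
    using q near t by (intro powr_mono2) auto
  also have "\<dots> = \<sigma> powr (2 / q) * (C * r) powr 2"
    using q \<sigma> C r by (simp add: powr_mult powr_powr)
  also have "(C * r) powr 2 = (C * r)\<^sup>2" using C r by simp
  finally show ?thesis using t by (simp add: power_mult_distrib mult_ac)
qed

theorem mainTheorem3:
  fixes N :: nat and d :: "nat \<Rightarrow> nat" and c :: "nat \<Rightarrow> nat \<Rightarrow> 'n::finite"
    and f :: "real ^ 'n \<Rightarrow> real" and g :: "real ^ 'n \<Rightarrow> ereal"
    and gs :: "nat \<Rightarrow> (nat \<Rightarrow> real) \<Rightarrow> ereal"
    and M :: "nat \<Rightarrow> real" and x :: "nat \<Rightarrow> real ^ 'n"
    and X :: "(real ^ 'n) set" and Fstar \<sigma> q \<gamma> \<epsilon> :: real and k0 :: nat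
    and F :: "real ^ 'n \<Rightarrow> ereal" and \<Delta> :: "nat \<Rightarrow> real"
  defines "F \<equiv> objective f g"
    and "\<Delta> \<equiv> gap F Fstar x"
  assumes blocks: "block_structure N d c"
    and A1i: "assumption1_i N d c f g gs"
    and A1ii: "assumption1_ii f g"
    and alg: "RCCM N d c f g gs M x"
    and M_pos: "\<And>i. i \<in> {1..N} \<Longrightarrow> 0 < M i"
    and bdd: "bounded (range x)"
    and KL: "KL_property F X Fstar \<sigma> q \<gamma> \<epsilon>"
    and near: "\<And>k. k \<ge> k0 \<Longrightarrow>
      infdist (x k) X \<le> \<gamma> \<and> ereal Fstar < F (x k) \<and> F (x k) < ereal (Fstar + \<epsilon>)"
  shows "\<exists>C>0.
    (\<forall>k. \<exists>s. is_arg_min norm (\<lambda>s. s \<in> limiting_subdiff F (x (Suc k))) s \<and>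
             norm s \<le> C * norm (x (Suc k) - x k)) \<and>
    (let \<mu> = Min (M ` {1..N}) / (2 * C\<^sup>2 * \<sigma> powr (2 / q)) in
       \<mu> > 0 \<and>
       (q < 2 \<longrightarrow> \<Delta> \<in> O(\<lambda>k. real k powr (- (q / (2 - q))))) \<and>
       (q = 2 \<longrightarrow> (\<forall>k\<ge>k0. \<Delta> k \<le> (1 / (1 + \<mu>)) ^ (k - k0) * \<Delta> k0)) \<and>
       (q > 2 \<longrightarrow>
          (\<exists>\<delta>>0. \<forall>k\<ge>k0. \<Delta> k \<le> \<delta> \<longrightarrow> \<Delta> (Suc k) \<le> (\<Delta> k / \<mu>) powr (q / 2)) \<and>
          \<Delta> \<longlonglongrightarrow> 0 \<and>
          (\<lambda>k. \<Delta> (Suc k) / \<Delta> k) \<longlonglongrightarrow> 0))"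
proof -
  obtain C where C: "0 < C" and sub: "\<And>k. \<exists>s\<in>limiting_subdiff F (x (Suc k)).
      norm s \<le> C * norm (x (Suc k) - x k)"
    using subgradient_bound[OF blocks A1i alg bdd] unfolding F_def by blast
  have q: "1 < q" and \<sigma>: "0 < \<sigma>" using KL by (auto simp: KL_property_def)
  define m where "m = Min (M ` {1..N})"
  have m: "0 < m" using blocks_nonempty[OF blocks] M_pos by (simp add: m_def)
  have mM: "m \<le> M i" if "i \<in> {1..N}" for i using that by (simp add: m_def)
  \<comment> \<open>Scaled so that \<mu> times the KL bound is exactly the decrease
    \<open>m / 2 * r\<^sup>2\<close> of one sweep.\<close>
  define \<mu> where "\<mu> = m / (2 * C\<^sup>2 * \<sigma> powr (2 / q))"
  have \<mu>: "0 < \<mu>" using m C \<sigma> by (simp add: \<mu>_def)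
  have least: "\<exists>s. is_arg_min norm (\<lambda>s. s \<in> limiting_subdiff F (x (Suc k))) s \<and>
      norm s \<le> C * norm (x (Suc k) - x k)" for k
    using sub[of k] limiting_subdiff_least_norm by (metis order_trans)
  have pos: "0 < \<Delta> k" if "k0 \<le> k" for k
    using near[OF that] by (cases "F (x k)") (auto simp: \<Delta>_def gap_def)
  \<comment> \<open>KL is applied at the new iterate \<open>x (Suc k)\<close>, where the subgradient
    is available, and descent is applied to the step leading there.\<close>
  have rec: "\<mu> * \<Delta> (Suc k) powr (2 / q) \<le> \<Delta> k - \<Delta> (Suc k)" if k: "k0 \<le> k" for k
  proof -
    let ?r = "norm (x (Suc k) - x k)"
    have "\<Delta> (Suc k) powr (2 / q) \<le> C\<^sup>2 * \<sigma> powr (2 / q) * ?r\<^sup>2"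
      unfolding \<Delta>_def gap_def using near[of "Suc k"] k sub[of k] C by (auto intro: KL_step[OF KL])
    then have "\<mu> * \<Delta> (Suc k) powr (2 / q) \<le> \<mu> * (C\<^sup>2 * \<sigma> powr (2 / q) * ?r\<^sup>2)"
      using \<mu> by (intro mult_left_mono) auto
    also have "\<dots> = m / 2 * ?r\<^sup>2" using C \<sigma> by (simp add: \<mu>_def)
    also have "\<dots> \<le> \<Delta> k - \<Delta> (Suc k)"
      using descent[OF blocks A1i alg mM, where k=k] by (simp add: \<Delta>_def gap_def F_def)
    finally show ?thesis .
  qed
  \<comment> \<open>For \<open>q = 2\<close> the exponent \<open>2 / q\<close> is 1, so the
    recurrence is a linear contraction.\<close>
  have b: "\<Delta> k \<le> (1 / (1 + \<mu>)) ^ (k - k0) * \<Delta> k0" if "q = 2" "k0 \<le> k" for k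
    using that(2)
  proof (induction rule: dec_induct)
    case (step k)
    have "\<Delta> (Suc k) * (1 + \<mu>) \<le> \<Delta> k"
      using rec[of k] step pos[of "Suc k"] that(1) by (simp add: algebra_simps)
    then have "\<Delta> (Suc k) \<le> 1 / (1 + \<mu>) * \<Delta> k" using \<mu> by (simp add: field_simps)
    also have "\<dots> \<le> 1 / (1 + \<mu>) * ((1 / (1 + \<mu>)) ^ (k - k0) * \<Delta> k0)"
      using step \<mu> by (intro mult_left_mono) auto
    finally show ?case using step by (simp add: Suc_diff_le)
  qed simp
  show ?thesis
  proof (rule exI[of _ C], unfold Let_def m_def[symmetric] \<mu>_def[symmetric], intro conjI impI allI)
    show "\<exists>\<delta>>0. \<forall>k\<ge>k0. \<Delta> k \<le> \<delta> \<longrightarrow> \<Delta> (Suc k) \<le> (\<Delta> k / \<mu>) powr (q / 2)" if "2 < q"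
      \<comment> \<open>The one-step bound holds for every \<open>k\<close> from \<open>k0\<close>
        on, whatever the size of the gap, so any positive \<delta> works; 1 is an arbitrary
        choice.\<close>
      using power_recurrence_superlinear(1)[of \<mu> q k0 \<Delta>, OF \<mu> that pos rec] by (intro exI[of _ 1]) simp
    show "\<Delta> \<longlonglongrightarrow> 0" and "(\<lambda>k. \<Delta> (Suc k) / \<Delta> k) \<longlonglongrightarrow> 0" if "2 < q"
      using power_recurrence_superlinear(2,3)[of \<mu> q k0 \<Delta>, OF \<mu> that pos rec] by blast+
    show "\<Delta> \<in> O(\<lambda>k. real k powr (- (q / (2 - q))))" if "q < 2"
      using power_recurrence_sublinear[of \<mu> q k0 \<Delta>, OF \<mu> _ that pos rec] q by simp
  qed (fact C \<mu> | rule least | erule (1) b)+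
qed

end
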